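(* Let $S$ be a fountain set in dimension $d$, and let $B_S$ be the set of generating tiles of $S$. Let $\mathcal{R}$ be the set of all connected polyominoes in dimension $d$ inside of which at least one copy of some tile $b\in B_S$ can fit. Then the set $S$ can tile any polyomino $R\in\mathcal{R}$. Furthermore, there exists an algorithm that generates a tiling of $R$ with $S$ when one exists.
   Context: A polyomino in dimension $d$ is a finite union of unit $d$-dimensional cubes of the grid $\mathbb{Z}^d$ that is connected (through cubes sharing a $(d-1)$-dimensional face); it need not be simply connected. A tile is a simply connected polyomino. Tiles may be rotated: a copy of a tile is its image under a grid-preserving rotation followed by an integer translation, and tiles differing by a rotation are regarded as the same. A set of tiles $S$ tiles a polyomino $R$ if $R$ can be entirely covered, without overlap and without leaving $R$, by any number of copies of tiles of $S$; such a covering is a tiling of $R$ with $S$. A tile fits inside a polyomino if some copy of the tile is contained in it. A tile set $S$ is a fountain set if every polyomino composed of a single tile of $S$ plus any one unit cube adjacent to it (sharing a $(d-1)$-dimensional face with a cube of the tile and not belonging to the tile) is tileable by $S$. The set $B_S$ of generating tiles of a fountain set $S$ is the set of all tiles $b\in S$ such that no tile $t\in S\setminus\{b\}$ can fit inside $b$. *)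

theory Defs
  imports "HOL-Analysis.Analysis" "HOL-Library.Nat_Bijection"
begin

section \<open>Polyominoes\<close>

text \<open>
  The dimension is \<open>CARD('n)\<close>. A polyomino is given by its finite set of cells; the cell
  \<open>z\<close> stands for the closed unit cube with centre \<open>z\<close>. Centring the cubes at the integer
  points (instead of placing a corner there) shifts the grid by a half, and makes an integer matrix
  act on cubes exactly as it acts on their labels.
\<close>

type_synonym 'n cell = "int ^ 'n"

definition cube :: "'n::finite cell \<Rightarrow> (real ^ 'n) set" where
  "cube z = cbox (\<chi> i. of_int (z $ i) - 1/2) (\<chi> i. of_int (z $ i) + 1/2)"

definition region :: "'n::finite cell set \<Rightarrow> (real ^ 'n) set" where
  "region P = (\<Union>z\<in>P. cube z)"

text \<open>Two different cubes share a facet iff their centres differ by a unit step along one axis.\<close>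

definition adjacent :: "'n::finite cell \<Rightarrow> 'n cell \<Rightarrow> bool" where
  "adjacent x y \<longleftrightarrow> (\<exists>i. \<bar>x $ i - y $ i\<bar> = 1 \<and> (\<forall>j. j \<noteq> i \<longrightarrow> x $ j = y $ j))"

definition face_connected :: "'n::finite cell set \<Rightarrow> bool" where
  "face_connected P \<longleftrightarrow>
     (\<forall>x\<in>P. \<forall>y\<in>P. (x, y) \<in> {(u, v). u \<in> P \<and> v \<in> P \<and> adjacent u v}\<^sup>*)"

definition polyomino :: "'n::finite cell set \<Rightarrow> bool" where
  "polyomino P \<longleftrightarrow> finite P \<and> P \<noteq> {} \<and> face_connected P"

definition tile :: "'n::finite cell set \<Rightarrow> bool" where
  "tile P \<longleftrightarrow> polyomino P \<and> simply_connected (region P)"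


section \<open>Copies and tilings\<close>

text \<open>
  An integer matrix is a \<^const>\<open>rotation_matrix\<close> iff it is a signed permutation matrix of
  determinant 1, i.e. a rotation preserving the grid; reflections are excluded.
\<close>

definition copy_of :: "'n::finite cell set \<Rightarrow> 'n cell set \<Rightarrow> bool" where
  "copy_of P t \<longleftrightarrow> (\<exists>(Q :: int ^ 'n ^ 'n) v. rotation_matrix Q \<and> P = (\<lambda>x. Q *v x + v) ` t)"

definition fits :: "'n::finite cell set \<Rightarrow> 'n cell set \<Rightarrow> bool" where
  "fits t R \<longleftrightarrow> (\<exists>P. copy_of P t \<and> P \<subseteq> R)"

text \<open>A tiling is the set of the placed copies.\<close>

definition tiling :: "'n::finite cell set set \<Rightarrow> 'n cell set \<Rightarrow> 'n cell set set \<Rightarrow> bool" where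
  "tiling S R T \<longleftrightarrow> (\<forall>P\<in>T. \<exists>t\<in>S. copy_of P t) \<and> disjoint T \<and> \<Union>T = R"

definition tileable :: "'n::finite cell set set \<Rightarrow> 'n cell set \<Rightarrow> bool" where
  "tileable S R \<longleftrightarrow> (\<exists>T. tiling S R T)"


section \<open>Fountain sets\<close>

definition fountain_set :: "'n::finite cell set set \<Rightarrow> bool" where
  "fountain_set S \<longleftrightarrow> (\<forall>t\<in>S. tile t) \<and>
     (\<forall>t\<in>S. \<forall>c. c \<notin> t \<and> (\<exists>x\<in>t. adjacent x c) \<longrightarrow> tileable S (insert c t))"

text \<open>
  A tile set consists of representatives of tiles, two of them being the same tile if one is a copy
  of the other. So the condition \<open>t \<in> S - {b}\<close> is expressed by \<^term>\<open>\<not> copy_of t b\<close>.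
\<close>

definition generating_tiles :: "'n::finite cell set set \<Rightarrow> 'n cell set set" where
  "generating_tiles S = {b \<in> S. \<forall>t\<in>S. \<not> copy_of t b \<longrightarrow> \<not> fits t b}"

definition generated_class :: "'n::finite cell set set \<Rightarrow> 'n cell set set" where
  "generated_class S = {R. polyomino R \<and> (\<exists>b\<in>generating_tiles S. fits b R)}"


section \<open>Algorithms\<close>

text \<open>
  Algorithms are the usual schemes for partial recursive functions on natural numbers;
  \<open>computes f xs y\<close> means that \<open>f\<close> halts on the arguments \<open>xs\<close> with result \<open>y\<close>.
\<close>

datatype recf = Zero | Succ | Proj nat | Comp recf "recf list" | PrimRec recf recf | Mu recf

inductive computes :: "recf \<Rightarrow> nat list \<Rightarrow> nat \<Rightarrow> bool" where
  Zero: "computes Zero xs 0"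
| Succ: "computes Succ (x # xs) (Suc x)"
| Proj: "i < length xs \<Longrightarrow> computes (Proj i) xs (xs ! i)"
| Comp: "list_all2 (\<lambda>g y. computes g xs y) gs ys \<Longrightarrow> computes f ys z \<Longrightarrow> computes (Comp f gs) xs z"
| PrimRec_0: "computes f xs y \<Longrightarrow> computes (PrimRec f g) (0 # xs) y"
| PrimRec_Suc: "computes (PrimRec f g) (n # xs) y \<Longrightarrow> computes g (n # y # xs) z \<Longrightarrow>
    computes (PrimRec f g) (Suc n # xs) z"
| Mu: "computes f (n # xs) 0 \<Longrightarrow> (\<And>m. m < n \<Longrightarrow> \<exists>y>0. computes f (m # xs) y) \<Longrightarrow>
    computes (Mu f) xs n"
monos list_all2_mono

inductive_cases computes_ZeroE: "computes Zero xs y"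
inductive_cases computes_SuccE: "computes Succ xs y"
inductive_cases computes_ProjE: "computes (Proj i) xs y"
inductive_cases computes_CompE: "computes (Comp f gs) xs y"
inductive_cases computes_PrimRec_0E: "computes (PrimRec f g) (0 # xs) y"
inductive_cases computes_PrimRec_SucE: "computes (PrimRec f g) (Suc n # xs) y"
inductive_cases computes_MuE: "computes (Mu f) xs y"

lemma computes_deterministic: "computes f xs y \<Longrightarrow> computes f xs z \<Longrightarrow> y = z"
proof (induction f xs y arbitrary: z rule: computes.induct)
  case (Zero xs)
  then show ?case by (rule computes_ZeroE) simp
next
  case (Succ x xs)
  then show ?case by (rule computes_SuccE) simp
next
  case (Proj i xs)
  from Proj.prems show ?case by (rule computes_ProjE) simp
next
  case (Comp xs gs ys f w)
  from Comp.prems obtain ys' where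
    ys': "list_all2 (\<lambda>g y. computes g xs y) gs ys'" "computes f ys' z"
    by (rule computes_CompE)
  have "ys = ys'"
  proof (rule nth_equalityI)
    show "length ys = length ys'"
      using Comp.IH(1) ys'(1) by (simp add: list_all2_conv_all_nth)
    show "ys ! i = ys' ! i" if "i < length ys" for i
      using Comp.IH(1) ys'(1) that by (simp add: list_all2_conv_all_nth)
  qed
  then show ?case using Comp.IH(2) ys'(2) by blast
next
  case (PrimRec_0 f xs y g)
  from PrimRec_0.prems have "computes f xs z" by (rule computes_PrimRec_0E)
  then show ?case by (rule PrimRec_0.IH)
next
  case (PrimRec_Suc f g n xs y w)
  from PrimRec_Suc.prems obtain y' where
    "computes (PrimRec f g) (n # xs) y'" "computes g (n # y' # xs) z"
    by (rule computes_PrimRec_SucE)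
  then show ?case using PrimRec_Suc.IH by blast
next
  case (Mu f n xs)
  from Mu.prems have z: "computes f (z # xs) 0 \<and> (\<forall>m<z. \<exists>y>0. computes f (m # xs) y)"
    by (rule computes_MuE) simp
  have "\<not> n < z" using z Mu.IH(1) by (metis less_irrefl)
  moreover have "\<not> z < n" using z Mu.IH(2)[of z] by (metis less_irrefl)
  ultimately show ?case by simp
qed

text \<open>
  Codes of cells, of finite sets of cells and of finite families of such sets. The function
  \<^term>\<open>from_nat_into UNIV :: nat \<Rightarrow> 'n::finite\<close> enumerates the axes without repetition on the
  numbers below \<open>CARD('n)\<close>.
\<close>

definition cell_code :: "'n::finite cell \<Rightarrow> nat" where
  "cell_code z = list_encode (map (\<lambda>k. int_encode (z $ from_nat_into UNIV k)) [0..<CARD('n)])"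

definition poly_code :: "'n::finite cell set \<Rightarrow> nat" where
  "poly_code P = set_encode (cell_code ` P)"

definition family_code :: "'n::finite cell set set \<Rightarrow> nat" where
  "family_code F = set_encode (poly_code ` F)"

lemma inj_cell_code: "inj (cell_code :: 'n::finite cell \<Rightarrow> nat)"
proof (rule injI)
  fix x y :: "'n cell"
  assume "cell_code x = cell_code y"
  then have *: "x $ from_nat_into UNIV k = y $ from_nat_into UNIV k" if "k < CARD('n)" for k
    using that by (auto simp: cell_code_def list_encode_eq int_encode_eq)
  have "x $ i = y $ i" for i
  proof -
    have "i \<in> from_nat_into UNIV ` {..<CARD('n)}"
      using bij_betw_from_nat_into_finite[of "UNIV :: 'n set"] by (simp add: bij_betw_def)
    then show ?thesis using * by auto
  qed
  then show "x = y" by (simp add: vec_eq_iff)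
qed

lemma inj_poly_code: "inj_on poly_code {P :: 'n::finite cell set. finite P}"
  by (auto intro!: inj_onI simp: poly_code_def set_encode_eq inj_image_eq_iff[OF inj_cell_code])

lemma inj_family_code:
  "inj_on family_code {F :: 'n::finite cell set set. finite F \<and> (\<forall>P\<in>F. finite P)}"
proof (rule inj_onI)
  fix F G :: "'n cell set set"
  assume F: "F \<in> {F. finite F \<and> (\<forall>P\<in>F. finite P)}" and G: "G \<in> {F. finite F \<and> (\<forall>P\<in>F. finite P)}"
    and "family_code F = family_code G"
  then have "poly_code ` F = poly_code ` G"
    by (simp add: family_code_def set_encode_eq)
  moreover have "F \<subseteq> {P. finite P}" "G \<subseteq> {P. finite P}" using F G by auto
  ultimately show "F = G" using inj_on_image_eq_iff[OF inj_poly_code] by metis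
qed

text \<open>
  An algorithm can only be handed finitely many tiles, whereas a fountain set may be infinite. For
  a finite \<open>S\<close> the input may be \<open>S\<close> itself; in general it is any finite part of \<open>S\<close> which
  contains, up to copies, every tile of \<open>S\<close> that fits inside \<open>R\<close>.
\<close>

definition presents :: "'n::finite cell set set \<Rightarrow> 'n cell set set \<Rightarrow> 'n cell set \<Rightarrow> bool" where
  "presents F S R \<longleftrightarrow> finite F \<and> F \<subseteq> S \<and> (\<forall>t\<in>S. fits t R \<longrightarrow> (\<exists>t'\<in>F. copy_of t' t))"

end

theory Submission
  imports Defs
begin

text \<open>
  Start with one copy of a tile inside \<open>R\<close>, which is a tiled part of \<open>R\<close>. As long as this part is not
  all of \<open>R\<close>, connectedness provides a cell of \<open>R\<close> outside of it that is adjacent to a cell inside; if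
  \<open>P\<close> is the placed copy covering the latter, the fountain property retiles \<open>P\<close> together with the new
  cell, and the other copies stay. For the algorithm, a tiling of \<open>R\<close> is a family of subsets of \<open>R\<close>, so its
  code is below \<open>2 ^ Suc r\<close> with \<open>r\<close> the code of \<open>R\<close>; there are finitely many grid rotations, so being
  a tiling is a decidable property of codes, and a search up to that bound finds one if there is any.
\<close>

section \<open>Copies of tiles\<close>

text \<open>As a simp rule it turns \<open>transpose Q *v x\<close> into \<open>x v* Q\<close>, a
  form that the cancellation rules below do not match.\<close>

declare transpose_matrix_vector [simp del]

lemma rotation_matrix_mul:
  fixes A B :: "int ^ 'n ^ 'n::finite"
  assumes "rotation_matrix A" "rotation_matrix B"
  shows "rotation_matrix (A ** B)"
proof -
  have A: "transpose A ** A = mat 1" "A ** transpose A = mat 1" "det A = 1"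
    and B: "transpose B ** B = mat 1" "B ** transpose B = mat 1" "det B = 1"
    using assms by (auto simp: rotation_matrix_def orthogonal_matrix_def)
  have "transpose (A ** B) ** (A ** B) = transpose B ** (transpose A ** A) ** B"
    by (simp only: matrix_transpose_mul matrix_mul_assoc)
  moreover have "(A ** B) ** transpose (A ** B) = A ** (B ** transpose B) ** transpose A"
    by (simp only: matrix_transpose_mul matrix_mul_assoc)
  ultimately show ?thesis
    using A B by (simp add: rotation_matrix_def orthogonal_matrix_def det_mul)
qed

lemma rotation_matrix_transpose:
  fixes Q :: "int ^ 'n ^ 'n::finite"
  assumes "rotation_matrix Q"
  shows "rotation_matrix (transpose Q)"
  using assms by (simp add: rotation_matrix_def orthogonal_matrix_def det_transpose)

lemma rotation_matrix_cancel:
  fixes Q :: "int ^ 'n ^ 'n::finite"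
  assumes "rotation_matrix Q"
  shows "transpose Q *v (Q *v x) = x" "Q *v (transpose Q *v x) = x"
  using assms by (simp_all add: rotation_matrix_def orthogonal_matrix_def matrix_vector_mul_assoc)

lemma copy_of_sym:
  fixes P t :: "'n::finite cell set"
  assumes "copy_of P t"
  shows "copy_of t P"
proof -
  obtain Q :: "int ^ 'n ^ 'n" and v where Q: "rotation_matrix Q" and P: "P = (\<lambda>x. Q *v x + v) ` t"
    using assms by (auto simp: copy_of_def)
  have "t = (\<lambda>x. transpose Q *v x + - (transpose Q *v v)) ` P"
    by (simp add: P image_image matrix_vector_right_distrib rotation_matrix_cancel[OF Q])
  then show ?thesis
    using rotation_matrix_transpose[OF Q] unfolding copy_of_def by blast
qed

lemma copy_of_trans:
  fixes P t u :: "'n::finite cell set"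
  assumes "copy_of P t" "copy_of t u"
  shows "copy_of P u"
proof -
  obtain A B :: "int ^ 'n ^ 'n" and v w
    where A: "rotation_matrix A" and B: "rotation_matrix B"
      and P: "P = (\<lambda>x. A *v x + v) ` t" and t: "t = (\<lambda>x. B *v x + w) ` u"
    using assms by (auto simp: copy_of_def)
  have "P = (\<lambda>x. (A ** B) *v x + (A *v w + v)) ` u"
    by (simp add: P t image_image matrix_vector_right_distrib matrix_vector_mul_assoc add.assoc)
  then show ?thesis
    using rotation_matrix_mul[OF A B] unfolding copy_of_def by blast
qed

section \<open>Invariance of adjacency under grid rotations\<close>

text \<open>Integer squares add up to 1 only if one of them is 1 and the others vanish. In this form
  adjacency depends on a norm alone, and rotations preserve norms.\<close>

lemma adjacent_iff_norm:
  fixes x y :: "'n::finite cell"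
  shows "adjacent x y \<longleftrightarrow> (\<Sum>i\<in>UNIV. (x $ i - y $ i)\<^sup>2) = 1"
proof
  assume "adjacent x y"
  then obtain i where i: "\<bar>x $ i - y $ i\<bar> = 1" and rest: "\<And>j. j \<noteq> i \<Longrightarrow> x $ j = y $ j"
    by (auto simp: adjacent_def)
  have "(\<Sum>j\<in>UNIV. (x $ j - y $ j)\<^sup>2) = (x $ i - y $ i)\<^sup>2 + (\<Sum>j\<in>UNIV - {i}. (x $ j - y $ j)\<^sup>2)"
    by (rule sum.remove) auto
  also have "(\<Sum>j\<in>UNIV - {i}. (x $ j - y $ j)\<^sup>2) = 0"
    using rest by (intro sum.neutral) auto
  also have "(x $ i - y $ i)\<^sup>2 = 1"
    using i by (simp add: power2_eq_1_iff abs_eq_iff')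
  finally show "(\<Sum>i\<in>UNIV. (x $ i - y $ i)\<^sup>2) = 1" by simp
next
  assume sum: "(\<Sum>i\<in>UNIV. (x $ i - y $ i)\<^sup>2) = 1"
  then obtain i where i: "x $ i \<noteq> y $ i"
    by (metis (no_types, lifting) diff_self power_zero_numeral sum.neutral zero_neq_one)
  let ?rest = "\<Sum>j\<in>UNIV - {i}. (x $ j - y $ j)\<^sup>2"
  have eq: "(x $ i - y $ i)\<^sup>2 + ?rest = 1"
    using sum by (simp add: sum.remove[of UNIV i])
  have pos: "(x $ i - y $ i)\<^sup>2 \<ge> 1"
    using i by (smt (verit) zero_less_power2)
  have nonneg: "?rest \<ge> 0" by (simp add: sum_nonneg)
  have "(x $ i - y $ i)\<^sup>2 = 1" "?rest = 0" using eq pos nonneg by linarith+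
  then have "\<bar>x $ i - y $ i\<bar> = 1" "\<forall>j. j \<noteq> i \<longrightarrow> x $ j = y $ j"
    by (auto simp: power2_eq_1_iff sum_nonneg_eq_0_iff)
  then show "adjacent x y" unfolding adjacent_def by blast
qed

text \<open>The transpose is the adjoint for the dot product: moving one factor \<open>Q\<close>
  across leaves \<open>transpose Q *v (Q *v x)\<close>, which is \<open>x\<close>.\<close>

lemma rotation_matrix_norm:
  fixes Q :: "int ^ 'n ^ 'n::finite"
  assumes "rotation_matrix Q"
  shows "(\<Sum>i\<in>UNIV. ((Q *v x) $ i)\<^sup>2) = (\<Sum>i\<in>UNIV. (x $ i)\<^sup>2)"
proof -
  have "(\<Sum>i\<in>UNIV. (Q *v x) $ i * w $ i) = (\<Sum>j\<in>UNIV. x $ j * (transpose Q *v w) $ j)" for w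
    by (simp add: matrix_vector_mult_def transpose_def sum_distrib_left sum_distrib_right)
      (subst sum.swap, simp add: ac_simps)
  from this[of "Q *v x"] show ?thesis
    by (simp add: power2_eq_square rotation_matrix_cancel[OF assms])
qed

lemma adjacent_rotation:
  fixes Q :: "int ^ 'n ^ 'n::finite"
  assumes "rotation_matrix Q"
  shows "adjacent (Q *v x + v) (Q *v y + v) \<longleftrightarrow> adjacent x y"
  using rotation_matrix_norm[OF assms, of "x - y"]
  by (simp add: adjacent_iff_norm matrix_vector_mult_diff_distrib)

section \<open>Growing a tiling cell by cell\<close>

lemma tileable_image:
  fixes Q :: "int ^ 'n ^ 'n::finite"
  assumes Q: "rotation_matrix Q" and P: "tileable S P"
  shows "tileable S ((\<lambda>x. Q *v x + v) ` P)"
proof -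
  let ?g = "\<lambda>x. Q *v x + v"
  obtain T where T: "\<And>X. X \<in> T \<Longrightarrow> \<exists>t\<in>S. copy_of X t" "disjoint T" "\<Union>T = P"
    using P by (auto simp: tileable_def tiling_def)
  have "inj ?g"
    by (rule inj_on_inverseI[of _ "\<lambda>x. transpose Q *v (x - v)"])
      (simp add: rotation_matrix_cancel[OF Q])
  then have "disjoint ((`) ?g ` T)"
    using T(2) unfolding disjoint_def by (auto simp: image_Int[symmetric] inj_image_eq_iff)
  moreover have "\<exists>t\<in>S. copy_of X t" if X: "X \<in> (`) ?g ` T" for X
  proof -
    obtain Y where Y: "Y \<in> T" "X = ?g ` Y" using X by blast
    then have "copy_of X Y" using Q by (auto simp: copy_of_def)
    then show ?thesis using T(1)[OF Y(1)] copy_of_trans by blast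
  qed
  moreover have "\<Union>((`) ?g ` T) = ?g ` P" using T(3) by blast
  ultimately show ?thesis unfolding tileable_def tiling_def by blast
qed

text \<open>The fountain property speaks of the tiles of \<open>S\<close> themselves. So the new
  cell is pulled back to a neighbour \<open>d\<close> of \<open>t\<close>, and the tiling found
  there is carried along by the motion.\<close>

lemma tileable_insert_copy:
  fixes P t :: "'n::finite cell set"
  assumes "fountain_set S" "t \<in> S" "copy_of P t" "x \<in> P" "c \<notin> P" "adjacent x c"
  shows "tileable S (insert c P)"
proof -
  obtain Q :: "int ^ 'n ^ 'n" and v where Q: "rotation_matrix Q" and P: "P = (\<lambda>x. Q *v x + v) ` t"
    using assms(3) by (auto simp: copy_of_def)
  obtain z where z: "z \<in> t" "x = Q *v z + v" using assms(4) P by blast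
  define d where "d = transpose Q *v (c - v)"
  have c: "c = Q *v d + v" by (simp add: d_def rotation_matrix_cancel[OF Q])
  have "d \<notin> t" using assms(5) c P by blast
  moreover have "adjacent z d" using assms(6) unfolding z(2) c adjacent_rotation[OF Q] .
  ultimately have "tileable S (insert d t)" using assms(1,2) z(1) unfolding fountain_set_def by blast
  from tileable_image[OF Q this] show ?thesis by (simp add: P c)
qed

lemma tileable_insert:
  assumes S: "fountain_set S" and P: "tileable S P" and x: "x \<in> P" "c \<notin> P" "adjacent x c"
  shows "tileable S (insert c P)"
proof -
  obtain T where T: "\<And>X. X \<in> T \<Longrightarrow> \<exists>t\<in>S. copy_of X t" "disjoint T" "\<Union>T = P"
    using P by (auto simp: tileable_def tiling_def)
  obtain X where X: "X \<in> T" "x \<in> X" using x(1) T(3) by blast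
  have "c \<notin> X" using X(1) T(3) x(2) by blast
  then have "tileable S (insert c X)"
    using tileable_insert_copy[OF S _ _ X(2) _ x(3)] T(1)[OF X(1)] by blast
  then obtain U where U: "\<And>Y. Y \<in> U \<Longrightarrow> \<exists>t\<in>S. copy_of Y t" "disjoint U" "\<Union>U = insert c X"
    by (auto simp: tileable_def tiling_def)
  \<comment> \<open>The copies that stay miss \<open>X\<close> since \<open>T\<close> is disjoint,
    and miss \<open>c\<close> since \<open>c\<close> is outside \<open>P\<close>.\<close>
  have "\<Union>(T - {X}) \<inter> insert c X = {}"
    using T(2,3) X(1) x(2) unfolding disjoint_def by auto
  then have "disjoint ((T - {X}) \<union> U)"
    using T(2) U(2,3) by (intro disjoint_union) (auto simp: disjoint_def)
  moreover have "\<Union>((T - {X}) \<union> U) = insert c P" using U(3) T(3) X(1) by auto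
  ultimately show ?thesis
    unfolding tileable_def tiling_def using T(1) U(1)
    by (intro exI[of _ "(T - {X}) \<union> U"]) blast
qed

text \<open>A path inside \<open>R\<close> from a cell of \<open>P\<close> to a cell outside
  \<open>P\<close> has to leave \<open>P\<close> at some step.\<close>

lemma face_connected_boundary:
  assumes "face_connected R" "P \<subseteq> R" "P \<noteq> {}" "P \<noteq> R"
  obtains x c where "x \<in> P" "c \<in> R - P" "adjacent x c"
proof -
  obtain a b where a: "a \<in> P" and b: "b \<in> R - P" using assms by blast
  let ?E = "{(u, v). u \<in> R \<and> v \<in> R \<and> adjacent u v}"
  have "(a, b) \<in> ?E\<^sup>*" using assms(1,2) a b unfolding face_connected_def by blast
  \<comment> \<open>Invariant along the path: either it is still in \<open>P\<close>, or a crossing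
    has been met.\<close>
  then have "b \<in> P \<or> (\<exists>x c. x \<in> P \<and> c \<in> R - P \<and> adjacent x c)"
    by (induction rule: rtrancl_induct) (use a in auto)
  then show thesis using b that by blast
qed

lemma tileable_extend:
  assumes S: "fountain_set S" and R: "polyomino R"
  shows "tileable S P \<Longrightarrow> P \<subseteq> R \<Longrightarrow> P \<noteq> {} \<Longrightarrow> tileable S R"
proof (induction "card (R - P)" arbitrary: P rule: less_induct)
  case less
  show ?case
  proof (cases "P = R")
    case False
    have "face_connected R" "finite R" using R by (auto simp: polyomino_def)
    then obtain x c where xc: "x \<in> P" "c \<in> R - P" "adjacent x c"
      using face_connected_boundary less.prems(2,3) False by metis
    have "R - insert c P \<subset> R - P" using xc(2) by blast
    then have "card (R - insert c P) < card (R - P)"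
      using \<open>finite R\<close> by (simp add: psubset_card_mono)
    moreover have "tileable S (insert c P)"
      using tileable_insert[OF S less.prems(1) xc(1) _ xc(3)] xc(2) by blast
    ultimately show ?thesis using less.hyps less.prems(2) xc(2) by blast
  qed (use less.prems in simp)
qed

lemma tileable_if_fits:
  assumes S: "fountain_set S" and R: "polyomino R" and t: "t \<in> S" "fits t R"
  shows "tileable S R"
proof -
  obtain P where P: "copy_of P t" "P \<subseteq> R" using t(2) by (auto simp: fits_def)
  \<comment> \<open>An empty starting part would have no boundary to grow from.\<close>
  have "t \<noteq> {}" using S t(1) by (auto simp: fountain_set_def tile_def polyomino_def)
  then have "P \<noteq> {}" using P(1) by (auto simp: copy_of_def)
  moreover have "tileable S P"
    unfolding tileable_def tiling_def using P(1) t(1)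
    by (intro exI[of _ "{P}"]) (auto simp: disjoint_def)
  ultimately show ?thesis using tileable_extend[OF S R] P(2) by blast
qed

section \<open>Total recursive functions\<close>

text \<open>
  In \<open>rec_fun k f\<close> the list is the environment of the \<open>k\<close> variables in scope, the innermost first:
  a binder is treated by passing from \<open>k\<close> to \<open>Suc k\<close>, with the bound variable being \<open>hd ys\<close> and the
  remaining ones being \<open>tl ys\<close>.
\<close>

definition rec_fun :: "nat \<Rightarrow> (nat list \<Rightarrow> nat) \<Rightarrow> bool" where
  "rec_fun k f \<longleftrightarrow> (\<exists>A. \<forall>xs. length xs = k \<longrightarrow> computes A xs (f xs))"

definition rec_pred :: "nat \<Rightarrow> (nat list \<Rightarrow> bool) \<Rightarrow> bool" where
  "rec_pred k P \<longleftrightarrow> rec_fun k (\<lambda>xs. of_bool (P xs))"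

text \<open>One closure rule per construct, so that \<open>intro rec_intros\<close> assembles a
  program along the syntax of an expression.\<close>

named_theorems rec_intros

lemma rec_fun_cong:
  "rec_fun k f \<Longrightarrow> (\<And>xs. length xs = k \<Longrightarrow> f xs = g xs) \<Longrightarrow> rec_fun k g"
  unfolding rec_fun_def by metis

lemma funpow_tl: "(tl ^^ j) xs = drop j xs"
  by (induction j) (simp_all add: drop_Suc tl_drop)

lemma rec_fun_var:
  assumes "j < k"
  shows "rec_fun k (\<lambda>xs. hd ((tl ^^ j) xs))"
  unfolding rec_fun_def
  using computes.Proj[of j] assms by (auto simp: funpow_tl hd_drop_conv_nth)

text \<open>The iterates of \<open>tl\<close> are unfolded to match variables as they appear under
  binders. The deepest concrete scopes, in \<open>copy_check\<close> and
  \<open>tiling_check\<close>, hold six variables.\<close>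

lemmas rec_fun_vars [rec_intros] =
  rec_fun_var[of 0, simplified]
  rec_fun_var[of "Suc 0", simplified]
  rec_fun_var[of "Suc (Suc 0)", simplified]
  rec_fun_var[of "Suc (Suc (Suc 0))", simplified]
  rec_fun_var[of "Suc (Suc (Suc (Suc 0)))", simplified]
  rec_fun_var[of "Suc (Suc (Suc (Suc (Suc 0))))", simplified]

lemma rec_fun_Comp:
  assumes "rec_fun (length fs) g" and "\<And>f. f \<in> set fs \<Longrightarrow> rec_fun k f"
  shows "rec_fun k (\<lambda>xs. g (map (\<lambda>f. f xs) fs))"
proof -
  obtain G where G: "\<And>ys. length ys = length fs \<Longrightarrow> computes G ys (g ys)"
    using assms(1) by (auto simp: rec_fun_def)
  have "\<forall>f\<in>set fs. \<exists>A. \<forall>xs. length xs = k \<longrightarrow> computes A xs (f xs)"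
    using assms(2) by (auto simp: rec_fun_def)
  then obtain A where A: "\<And>f xs. f \<in> set fs \<Longrightarrow> length xs = k \<Longrightarrow> computes (A f) xs (f xs)"
    by metis
  have "computes (Comp G (map A fs)) xs (g (map (\<lambda>f. f xs) fs))" if "length xs = k" for xs
    by (rule computes.Comp[where ys = "map (\<lambda>f. f xs) fs"])
      (auto simp: list_all2_conv_all_nth intro!: A G that)
  then show ?thesis unfolding rec_fun_def by blast
qed

text \<open>It then suffices to treat an operation on bare variables, in a small fixed
  scope.\<close>

lemma rec_fun_comp1:
  assumes "rec_fun (Suc 0) (\<lambda>ys. F (hd ys))" "rec_fun k f"
  shows "rec_fun k (\<lambda>xs. F (f xs))"
  using rec_fun_Comp[of "[f]" "\<lambda>ys. F (hd ys)" k] assms by simp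

lemma rec_fun_comp2:
  assumes "rec_fun (Suc (Suc 0)) (\<lambda>ys. F (hd ys) (hd (tl ys)))" "rec_fun k f" "rec_fun k g"
  shows "rec_fun k (\<lambda>xs. F (f xs) (g xs))"
  using rec_fun_Comp[of "[f, g]" "\<lambda>ys. F (hd ys) (hd (tl ys))" k] assms by auto

text \<open>Substitution for the innermost variable: compose with \<open>h\<close> followed by the
  \<open>k\<close> projections, which reproduce the environment.\<close>

lemma rec_fun_subst:
  assumes F: "rec_fun (Suc k) (\<lambda>ys. F (hd ys) (tl ys))" and h: "rec_fun k h"
  shows "rec_fun k (\<lambda>xs. F (h xs) xs)"
proof -
  let ?fs = "h # map (\<lambda>j xs. hd ((tl ^^ j) xs)) [0..<k]"
  have "rec_fun k (\<lambda>xs. (\<lambda>ys. F (hd ys) (tl ys)) (map (\<lambda>f. f xs) ?fs))"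
    using F h by (intro rec_fun_Comp) (auto intro: rec_fun_var)
  moreover have "map (\<lambda>j. hd ((tl ^^ j) xs)) [0..<k] = xs" if "length xs = k" for xs :: "nat list"
    by (rule nth_equalityI) (use that in \<open>auto simp: funpow_tl hd_drop_conv_nth\<close>)
  ultimately show ?thesis
    by (auto elim!: rec_fun_cong simp: comp_def)
qed

text \<open>Weakening: the projections from index 1 on drop the innermost variable.\<close>

lemma rec_fun_tl:
  assumes "rec_fun k f"
  shows "rec_fun (Suc k) (\<lambda>ys. f (tl ys))"
proof -
  let ?fs = "map (\<lambda>j xs. hd ((tl ^^ Suc j) xs)) [0..<k]"
  have "rec_fun (Suc k) (\<lambda>xs. f (map (\<lambda>f. f xs) ?fs))"
    using assms by (intro rec_fun_Comp) (auto intro: rec_fun_var simp del: funpow.simps)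
  moreover have "map (\<lambda>j. hd ((tl ^^ Suc j) xs)) [0..<k] = tl xs" if "length xs = Suc k"
    for xs :: "nat list"
    by (rule nth_equalityI) (use that in \<open>auto simp: funpow_tl hd_drop_conv_nth nth_tl simp del: funpow.simps\<close>)
  ultimately show ?thesis
    by (auto elim!: rec_fun_cong simp: comp_def simp del: funpow.simps)
qed

section \<open>Arithmetic by primitive recursion\<close>

lemma rec_fun_Suc [rec_intros]:
  assumes "rec_fun k f"
  shows "rec_fun k (\<lambda>xs. Suc (f xs))"
proof (rule rec_fun_comp1[OF _ assms])
  show "rec_fun (Suc 0) (\<lambda>ys. Suc (hd ys))"
    unfolding rec_fun_def by (rule exI[of _ Succ]) (auto simp: length_Suc_conv intro: computes.Succ)
qed

lemma rec_fun_const [rec_intros]: "rec_fun k (\<lambda>_. c)"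
proof (induction c)
  case 0
  show ?case unfolding rec_fun_def by (blast intro: computes.Zero)
qed (rule rec_fun_Suc)

lemma rec_fun_rec_nat [rec_intros]:
  assumes f: "rec_fun k f" and g: "rec_fun (Suc (Suc k)) (\<lambda>ys. g (hd ys) (hd (tl ys)) (tl (tl ys)))"
    and h: "rec_fun k h"
  shows "rec_fun k (\<lambda>xs. rec_nat (f xs) (\<lambda>i a. g i a xs) (h xs))"
proof (rule rec_fun_subst[OF _ h])
  obtain A B where A: "\<And>xs. length xs = k \<Longrightarrow> computes A xs (f xs)"
    and B: "\<And>ys. length ys = Suc (Suc k) \<Longrightarrow> computes B ys (g (hd ys) (hd (tl ys)) (tl (tl ys)))"
    using f g by (auto simp: rec_fun_def)
  have "computes (PrimRec A B) (n # xs) (rec_nat (f xs) (\<lambda>i a. g i a xs) n)"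
    if "length xs = k" for n xs
  proof (induction n)
    case 0
    show ?case using A[OF that] by (simp add: computes.PrimRec_0)
  next
    case (Suc n)
    then show ?case
      using computes.PrimRec_Suc B[of "n # _ # xs"] that by fastforce
  qed
  then show "rec_fun (Suc k) (\<lambda>ys. rec_nat (f (tl ys)) (\<lambda>i a. g i a (tl ys)) (hd ys))"
    unfolding rec_fun_def by (intro exI[of _ "PrimRec A B"]) (auto simp: length_Suc_conv)
qed

lemma rec_fun_add [rec_intros]:
  assumes "rec_fun k f" "rec_fun k g"
  shows "rec_fun k (\<lambda>xs. f xs + g xs)"
proof (rule rec_fun_comp2[OF _ assms])
  have "m + n = rec_nat m (\<lambda>i a. Suc a) n" for m n :: nat by (induction n) auto
  then show "rec_fun (Suc (Suc 0)) (\<lambda>ys. hd ys + hd (tl ys))"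
    by (simp only:) (intro rec_intros; simp)
qed

lemma rec_fun_diff [rec_intros]:
  assumes "rec_fun k f" "rec_fun k g"
  shows "rec_fun k (\<lambda>xs. f xs - g xs)"
proof (rule rec_fun_comp2[OF _ assms])
  \<comment> \<open>The predecessor: the recursion returns its last counter, and 0 at 0. Iterating
    it gives truncated subtraction.\<close>
  have "rec_nat 0 (\<lambda>i a. i) n = n - 1" for n :: nat by (cases n) auto
  then have "m - n = rec_nat m (\<lambda>i a. rec_nat 0 (\<lambda>i a. i) a) n" for m n :: nat
    by (induction n) auto
  then show "rec_fun (Suc (Suc 0)) (\<lambda>ys. hd ys - hd (tl ys))"
    by (simp only:) (intro rec_intros; simp)
qed

lemma rec_fun_mult [rec_intros]:
  assumes "rec_fun k f" "rec_fun k g"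
  shows "rec_fun k (\<lambda>xs. f xs * g xs)"
proof (rule rec_fun_comp2[OF _ assms])
  have "m * n = rec_nat 0 (\<lambda>i a. a + m) n" for m n :: nat by (induction n) auto
  then show "rec_fun (Suc (Suc 0)) (\<lambda>ys. hd ys * hd (tl ys))"
    by (simp only:) (intro rec_intros; simp)
qed

lemma rec_fun_power [rec_intros]:
  assumes "rec_fun k f" "rec_fun k g"
  shows "rec_fun k (\<lambda>xs. f xs ^ g xs)"
proof (rule rec_fun_comp2[OF _ assms])
  have "m ^ n = rec_nat 1 (\<lambda>i a. a * m) n" for m n :: nat by (induction n) auto
  then show "rec_fun (Suc (Suc 0)) (\<lambda>ys. hd ys ^ hd (tl ys))"
    by (simp only:) (intro rec_intros; simp)
qed

section \<open>Connectives, comparisons and finite quantifiers\<close>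

lemma rec_fun_of_bool [rec_intros]: "rec_pred k P \<Longrightarrow> rec_fun k (\<lambda>xs. of_bool (P xs))"
  by (simp add: rec_pred_def)

lemma rec_pred_not [rec_intros]:
  assumes "rec_pred k P"
  shows "rec_pred k (\<lambda>xs. \<not> P xs)"
proof -
  have "rec_fun k (\<lambda>xs. 1 - of_bool (P xs))" by (intro rec_intros assms)
  then show ?thesis unfolding rec_pred_def by (rule rec_fun_cong) simp
qed

lemma rec_pred_and [rec_intros]:
  assumes "rec_pred k P" "rec_pred k Q"
  shows "rec_pred k (\<lambda>xs. P xs \<and> Q xs)"
proof -
  have "rec_fun k (\<lambda>xs. of_bool (P xs) * of_bool (Q xs))" by (intro rec_intros assms)
  then show ?thesis unfolding rec_pred_def by (rule rec_fun_cong) simp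
qed

lemma rec_pred_or [rec_intros]:
  assumes "rec_pred k P" "rec_pred k Q"
  shows "rec_pred k (\<lambda>xs. P xs \<or> Q xs)"
proof -
  have "rec_pred k (\<lambda>xs. \<not> (\<not> P xs \<and> \<not> Q xs))" by (intro rec_intros assms)
  then show ?thesis by simp
qed

lemma rec_pred_imp [rec_intros]:
  assumes "rec_pred k P" "rec_pred k Q"
  shows "rec_pred k (\<lambda>xs. P xs \<longrightarrow> Q xs)"
proof -
  have "rec_pred k (\<lambda>xs. \<not> P xs \<or> Q xs)" by (intro rec_intros assms)
  then show ?thesis by (simp only: imp_conv_disj)
qed

lemma rec_pred_le [rec_intros]:
  assumes "rec_fun k f" "rec_fun k g"
  shows "rec_pred k (\<lambda>xs. f xs \<le> g xs)"
proof -
  have "rec_fun k (\<lambda>xs. 1 - (f xs - g xs))" by (intro rec_intros assms)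
  then show ?thesis unfolding rec_pred_def by (rule rec_fun_cong) simp
qed

lemma rec_pred_less [rec_intros]:
  assumes "rec_fun k f" "rec_fun k g"
  shows "rec_pred k (\<lambda>xs. f xs < g xs)"
proof -
  have "rec_pred k (\<lambda>xs. Suc (f xs) \<le> g xs)" by (intro rec_intros assms)
  then show ?thesis by (simp add: Suc_le_eq)
qed

lemma rec_pred_eq [rec_intros]:
  assumes "rec_fun k f" "rec_fun k g"
  shows "rec_pred k (\<lambda>xs. f xs = g xs)"
proof -
  have "rec_pred k (\<lambda>xs. f xs \<le> g xs \<and> g xs \<le> f xs)" by (intro rec_intros assms)
  then show ?thesis by (simp only: order.eq_iff)
qed

text \<open>Here \<open>I\<close> is a fixed set of any type, so the quantifier unfolds into a
  conjunction within the program. It serves for the axes, and its dual for the rotations.\<close>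

lemma rec_pred_Ball_finite:
  assumes "finite I" "\<And>i. i \<in> I \<Longrightarrow> rec_pred k (P i)"
  shows "rec_pred k (\<lambda>xs. \<forall>i\<in>I. P i xs)"
  using assms
proof (induction I rule: finite_induct)
  case empty
  show ?case by (simp add: rec_pred_def rec_fun_const)
next
  case (insert i I)
  then have "rec_pred k (\<lambda>xs. P i xs \<and> (\<forall>i\<in>I. P i xs))" by (intro rec_intros) auto
  then show ?case by simp
qed

lemma rec_pred_Bex_finite:
  assumes "finite I" "\<And>i. i \<in> I \<Longrightarrow> rec_pred k (P i)"
  shows "rec_pred k (\<lambda>xs. \<exists>i\<in>I. P i xs)"
proof -
  have "rec_pred k (\<lambda>xs. \<not> (\<forall>i\<in>I. \<not> P i xs))"
    by (intro rec_intros rec_pred_Ball_finite assms)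
  then show ?thesis by simp
qed

lemma rec_fun_if [rec_intros]:
  assumes "rec_pred k P" "rec_fun k f" "rec_fun k g"
  shows "rec_fun k (\<lambda>xs. if P xs then f xs else g xs)"
proof -
  have "rec_fun k (\<lambda>xs. of_bool (P xs) * f xs + of_bool (\<not> P xs) * g xs)"
    by (intro rec_intros assms)
  then show ?thesis by (rule rec_fun_cong) simp
qed

section \<open>Unbounded and bounded search\<close>

text \<open>\<open>Mu\<close> looks for a zero, so it is applied to the characteristic function of
  the negation; \<open>ex\<close> makes the search halt on every input.\<close>

lemma rec_fun_Least:
  assumes P: "rec_pred (Suc k) (\<lambda>ys. P (hd ys) (tl ys))" and ex: "\<And>xs. \<exists>n. P n xs"
  shows "rec_fun k (\<lambda>xs. LEAST n. P n xs)"
proof -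
  have "rec_fun (Suc k) (\<lambda>ys. of_bool (\<not> P (hd ys) (tl ys)))" by (intro rec_intros P)
  then obtain A where A: "\<And>ys. length ys = Suc k \<Longrightarrow> computes A ys (of_bool (\<not> P (hd ys) (tl ys)))"
    by (auto simp: rec_fun_def)
  have "computes (Mu A) xs (LEAST n. P n xs)" if "length xs = k" for xs
  proof (rule computes.Mu)
    show "computes A ((LEAST n. P n xs) # xs) 0"
      using A[of "(LEAST n. P n xs) # xs"] LeastI_ex[OF ex] that by simp
    show "\<exists>y>0. computes A (m # xs) y" if "m < (LEAST n. P n xs)" for m
      using A[of "m # xs"] not_less_Least[OF that] \<open>length xs = k\<close> by (intro exI[of _ 1]) simp
  qed
  then show ?thesis unfolding rec_fun_def by blast
qed

text \<open>The second disjunct stops the search for any \<open>P\<close>: the value is the least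
  witness below \<open>f xs\<close> if there is one, and \<open>f xs\<close> otherwise.\<close>

lemma rec_fun_bounded_Least [rec_intros]:
  assumes "rec_pred (Suc k) (\<lambda>ys. P (hd ys) (tl ys))" "rec_fun k f"
  shows "rec_fun k (\<lambda>xs. LEAST n. P n xs \<or> f xs \<le> n)"
proof (rule rec_fun_Least)
  show "rec_pred (Suc k) (\<lambda>ys. P (hd ys) (tl ys) \<or> f (tl ys) \<le> hd ys)"
    by (intro rec_intros rec_fun_tl assms) simp
qed auto

lemma rec_pred_bex_less [rec_intros]:
  assumes "rec_pred (Suc k) (\<lambda>ys. P (hd ys) (tl ys))" "rec_fun k f"
  shows "rec_pred k (\<lambda>xs. \<exists>n<f xs. P n xs)"
proof -
  have "(\<exists>n<m. P n xs) \<longleftrightarrow> (LEAST n. P n xs \<or> m \<le> n) < m" (is "?L \<longleftrightarrow> ?n < m") for m xs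
  proof
    assume ?L
    then obtain n where "n < m" "P n xs" by blast
    then show "?n < m" by (intro le_less_trans[OF Least_le]) auto
  next
    have "P ?n xs \<or> m \<le> ?n" by (rule LeastI[of _ m]) simp
    then show ?L if "?n < m" using that by auto
  qed
  then show ?thesis
    by (simp only:) (intro rec_intros assms)
qed

lemma rec_fun_div [rec_intros]:
  assumes "rec_fun k f" "rec_fun k g"
  shows "rec_fun k (\<lambda>xs. f xs div g xs)"
proof (rule rec_fun_comp2[OF _ assms])
  \<comment> \<open>For \<open>n = 0\<close> the first disjunct stops the search at 0, the value of
    \<open>m div 0\<close>. Otherwise the bound \<open>m\<close> cuts off nothing, as the quotient
    is at most \<open>m\<close>.\<close>
  have "m div n = (LEAST q. (n = 0 \<or> m < Suc q * n) \<or> m \<le> q)" for m n :: nat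
  proof (cases "n = 0")
    case False
    show ?thesis
    proof (rule Least_equality[symmetric])
      show "(n = 0 \<or> m < Suc (m div n) * n) \<or> m \<le> m div n"
        using False dividend_less_div_times[of n m] by simp
      show "m div n \<le> q" if "(n = 0 \<or> m < Suc q * n) \<or> m \<le> q" for q
        using that False by (metis div_le_dividend le_trans less_Suc_eq_le less_mult_imp_div_less)
    qed
  qed simp
  then show "rec_fun (Suc (Suc 0)) (\<lambda>ys. hd ys div hd (tl ys))"
    by (simp only:) (intro rec_intros; simp)
qed

lemma rec_pred_even [rec_intros]:
  assumes "rec_fun k f"
  shows "rec_pred k (\<lambda>xs. even (f xs))"
proof -
  have "even m \<longleftrightarrow> m = m div 2 * 2" for m :: nat by presburger
  then show ?thesis by (simp only:) (intro rec_intros assms)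
qed

section \<open>Coded finite sets\<close>

lemma rec_pred_set_decode [rec_intros]:
  assumes "rec_fun k f" "rec_fun k g"
  shows "rec_pred k (\<lambda>xs. f xs \<in> set_decode (g xs))"
  unfolding set_decode_def mem_Collect_eq by (intro rec_intros assms)

text \<open>A binary digit 1 at place \<open>c\<close> forces \<open>2 ^ c \<le> m\<close>. This
  turns quantifiers over coded sets into bounded ones.\<close>

lemma set_decode_less: "c \<in> set_decode m \<Longrightarrow> c < m"
proof -
  assume "c \<in> set_decode m"
  then have "m div 2 ^ c \<noteq> 0" by (metis even_zero mem_Collect_eq set_decode_def)
  then show "c < m" by (meson div_less le_less_trans less_exp not_le order_less_le_trans)
qed

lemma rec_pred_bex_set_decode [rec_intros]:
  assumes "rec_pred (Suc k) (\<lambda>ys. P (hd ys) (tl ys))" "rec_fun k f"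
  shows "rec_pred k (\<lambda>xs. \<exists>c\<in>set_decode (f xs). P c xs)"
proof -
  have "(\<exists>c\<in>set_decode m. P c xs) \<longleftrightarrow> (\<exists>c<m. c \<in> set_decode m \<and> P c xs)" for m xs
    using set_decode_less by blast
  then show ?thesis
    by (simp only:) (intro rec_intros rec_fun_tl assms; simp)
qed

lemma rec_pred_ball_set_decode [rec_intros]:
  assumes "rec_pred (Suc k) (\<lambda>ys. P (hd ys) (tl ys))" "rec_fun k f"
  shows "rec_pred k (\<lambda>xs. \<forall>c\<in>set_decode (f xs). P c xs)"
proof -
  have "rec_pred k (\<lambda>xs. \<not> (\<exists>c\<in>set_decode (f xs). \<not> P c xs))" by (intro rec_intros assms)
  then show ?thesis by simp
qed

section \<open>Deciding the tilings\<close>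

lemma rec_pred_comp2:
  assumes "rec_pred (Suc (Suc 0)) (\<lambda>ys. P (hd ys) (hd (tl ys)))" "rec_fun k f" "rec_fun k g"
  shows "rec_pred k (\<lambda>xs. P (f xs) (g xs))"
  using assms unfolding rec_pred_def by (rule rec_fun_comp2)

section \<open>Pairs and lists\<close>

lemma rec_fun_prod_encode [rec_intros]:
  assumes "rec_fun k f" "rec_fun k g"
  shows "rec_fun k (\<lambda>xs. prod_encode (f xs, g xs))"
  unfolding prod_encode_def triangle_def prod.case by (intro rec_intros assms)

lemma rec_fun_fst_prod_decode [rec_intros]:
  assumes "rec_fun k f"
  shows "rec_fun k (\<lambda>xs. fst (prod_decode (f xs)))"
proof (rule rec_fun_comp1[OF _ assms])
  \<comment> \<open>Pairing is inverted by search. Both components are at most \<open>m\<close>, so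
    the bounds lose nothing; \<open>b\<close> may equal \<open>m\<close>, hence
    \<open>Suc m\<close>.\<close>
  have "fst (prod_decode m) = (LEAST a. (\<exists>b<Suc m. m = prod_encode (a, b)) \<or> m \<le> a)" for m
  proof (rule Least_equality[symmetric])
    obtain a b where ab: "prod_decode m = (a, b)" by (cases "prod_decode m")
    then have m: "m = prod_encode (a, b)" by (metis prod_decode_inverse)
    then show "(\<exists>b<Suc m. m = prod_encode (fst (prod_decode m), b)) \<or> m \<le> fst (prod_decode m)"
      using le_prod_encode_2[of b a] by (auto simp: less_Suc_eq_le)
    show "fst (prod_decode m) \<le> a'" if "(\<exists>b<Suc m. m = prod_encode (a', b)) \<or> m \<le> a'" for a'
      using that m le_prod_encode_1[of a b] by auto
  qed
  then show "rec_fun (Suc 0) (\<lambda>ys. fst (prod_decode (hd ys)))"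
    by (simp only:) (intro rec_intros; simp)
qed

lemma rec_fun_snd_prod_decode [rec_intros]:
  assumes "rec_fun k f"
  shows "rec_fun k (\<lambda>xs. snd (prod_decode (f xs)))"
proof (rule rec_fun_comp1[OF _ assms])
  have "snd (prod_decode m) = (LEAST b. m = prod_encode (fst (prod_decode m), b) \<or> m \<le> b)" for m
  proof (rule Least_equality[symmetric])
    obtain a b where ab: "prod_decode m = (a, b)" by (cases "prod_decode m")
    then have m: "m = prod_encode (a, b)" by (metis prod_decode_inverse)
    then show "m = prod_encode (fst (prod_decode m), snd (prod_decode m)) \<or> m \<le> snd (prod_decode m)"
      by simp
    show "snd (prod_decode m) \<le> b'" if "m = prod_encode (fst (prod_decode m), b') \<or> m \<le> b'" for b'
      using that m le_prod_encode_2[of b a] by auto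
  qed
  moreover have "rec_fun (Suc 0)
      (\<lambda>ys. LEAST b. hd ys = prod_encode (fst (prod_decode (hd ys)), b) \<or> hd ys \<le> b)"
    by (intro rec_intros; simp)
  ultimately show "rec_fun (Suc 0) (\<lambda>ys. snd (prod_decode (hd ys)))" by simp
qed

text \<open>A nonempty list has the code \<open>Suc (prod_encode (x, list_encode l))\<close>, hence
  the \<open>c - 1\<close>. The index is fixed outside of the computation, with one program for each
  index.\<close>

primrec code_nth :: "nat \<Rightarrow> nat \<Rightarrow> nat" where
  "code_nth 0 c = fst (prod_decode (c - 1))"
| "code_nth (Suc k) c = code_nth k (snd (prod_decode (c - 1)))"

lemma code_nth_list_encode: "k < length l \<Longrightarrow> code_nth k (list_encode l) = l ! k"
proof (induction k arbitrary: l)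
  case 0
  then show ?case by (cases l) auto
next
  case (Suc k)
  then show ?case by (cases l) auto
qed

lemma rec_fun_code_nth [rec_intros]:
  "rec_fun k f \<Longrightarrow> rec_fun k (\<lambda>xs. code_nth n (f xs))"
proof (induction n arbitrary: f)
  case 0
  then show ?case unfolding code_nth.simps by (intro rec_intros)
next
  case (Suc n)
  show ?case unfolding code_nth.simps by (intro Suc.IH rec_intros Suc.prems)
qed

section \<open>Integer arithmetic\<close>

text \<open>Integers are differences of naturals, so sums and products need no case distinction on
  signs.\<close>

definition rec_int :: "nat \<Rightarrow> (nat list \<Rightarrow> int) \<Rightarrow> bool" where
  "rec_int k h \<longleftrightarrow> (\<exists>a b. rec_fun k a \<and> rec_fun k b \<and> (\<forall>xs. h xs = int (a xs) - int (b xs)))"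

lemma rec_intI:
  "rec_fun k a \<Longrightarrow> rec_fun k b \<Longrightarrow> (\<And>xs. h xs = int (a xs) - int (b xs)) \<Longrightarrow> rec_int k h"
  unfolding rec_int_def by blast

lemma rec_int_const [rec_intros]: "rec_int k (\<lambda>_. c)"
  by (rule rec_intI[of _ "\<lambda>_. nat c" "\<lambda>_. nat (- c)"]) (auto intro: rec_fun_const)

lemma rec_int_add [rec_intros]:
  assumes "rec_int k f" "rec_int k g"
  shows "rec_int k (\<lambda>xs. f xs + g xs)"
proof -
  obtain a b c d where "rec_fun k a" "rec_fun k b" "\<And>xs. f xs = int (a xs) - int (b xs)"
    and "rec_fun k c" "rec_fun k d" "\<And>xs. g xs = int (c xs) - int (d xs)"
    using assms unfolding rec_int_def by metis
  then show ?thesis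
    by (intro rec_intI[of _ "\<lambda>xs. a xs + c xs" "\<lambda>xs. b xs + d xs"] rec_intros) simp_all
qed

lemma rec_int_mult [rec_intros]:
  assumes "rec_int k f" "rec_int k g"
  shows "rec_int k (\<lambda>xs. f xs * g xs)"
proof -
  obtain a b c d where ab: "rec_fun k a" "rec_fun k b" "\<And>xs. f xs = int (a xs) - int (b xs)"
    and cd: "rec_fun k c" "rec_fun k d" "\<And>xs. g xs = int (c xs) - int (d xs)"
    using assms unfolding rec_int_def by metis
  show ?thesis
    by (intro rec_intI[of _ "\<lambda>xs. a xs * c xs + b xs * d xs" "\<lambda>xs. a xs * d xs + b xs * c xs"]
        rec_intros ab cd) (simp add: ab(3) cd(3) algebra_simps)
qed

lemma rec_int_diff [rec_intros]:
  assumes "rec_int k f" "rec_int k g"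
  shows "rec_int k (\<lambda>xs. f xs - g xs)"
proof -
  have "rec_int k (\<lambda>xs. f xs + (- 1) * g xs)" by (intro rec_intros assms)
  then show ?thesis by simp
qed

lemma rec_int_sum:
  assumes "finite I" "\<And>i. i \<in> I \<Longrightarrow> rec_int k (f i)"
  shows "rec_int k (\<lambda>xs. \<Sum>i\<in>I. f i xs)"
  using assms
proof (induction I rule: finite_induct)
  case empty
  show ?case by (simp add: rec_int_const)
next
  case (insert i I)
  then have "rec_int k (\<lambda>xs. f i xs + (\<Sum>i\<in>I. f i xs))" by (intro rec_intros) auto
  then show ?case using insert.hyps by simp
qed

lemma rec_int_int_decode [rec_intros]:
  assumes "rec_fun k f"
  shows "rec_int k (\<lambda>xs. int_decode (f xs))"
proof (rule rec_intI)
  \<comment> \<open>An even code \<open>2 * i\<close> stands for \<open>i\<close>, an odd code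
    \<open>2 * i + 1\<close> for \<open>- i - 1\<close>.\<close>
  show "rec_fun k (\<lambda>xs. if even (f xs) then f xs div 2 else 0)"
    "rec_fun k (\<lambda>xs. if even (f xs) then 0 else Suc (f xs div 2))"
    by (intro rec_intros assms)+
qed (simp add: int_decode_def sum_decode_def)

lemma rec_pred_int_eq [rec_intros]:
  assumes "rec_int k f" "rec_int k g"
  shows "rec_pred k (\<lambda>xs. f xs = g xs)"
proof -
  obtain a b c d where ab: "rec_fun k a" "rec_fun k b" "\<And>xs. f xs = int (a xs) - int (b xs)"
    and cd: "rec_fun k c" "rec_fun k d" "\<And>xs. g xs = int (c xs) - int (d xs)"
    using assms unfolding rec_int_def by metis
  have "f xs = g xs \<longleftrightarrow> a xs + d xs = c xs + b xs" for xs
    using ab(3)[of xs] cd(3)[of xs] by linarith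
  then show ?thesis by (simp only:) (intro rec_intros ab cd)
qed

section \<open>Cells, motions and copies in terms of codes\<close>

text \<open>\<open>to_nat_on\<close> undoes the numbering of the axes used in
  \<open>cell_code\<close>. The value is meaningful only on codes of cells.\<close>

definition coord :: "'n::finite \<Rightarrow> nat \<Rightarrow> int" where
  "coord i c = int_decode (code_nth (to_nat_on (UNIV :: 'n set) i) c)"

lemma coord_cell_code [simp]: "coord i (cell_code z) = z $ i"
proof -
  have "to_nat_on UNIV i < CARD('a)"
    using bij_betwE[OF to_nat_on_finite[OF finite_class.finite_UNIV]] by blast
  then show ?thesis
    by (simp add: coord_def cell_code_def code_nth_list_encode from_nat_into_to_nat_on countable_finite)
qed

text \<open>
  The arguments are codes of cells: the motion with linear part \<open>Q\<close> that takes \<open>z\<close> to \<open>x\<close> takes \<open>z'\<close>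
  to \<open>x'\<close>. As one pair of corresponding cells fixes the translation, no search for it is needed.
\<close>

definition moves_to :: "int ^ 'n ^ 'n::finite \<Rightarrow> nat \<Rightarrow> nat \<Rightarrow> nat \<Rightarrow> nat \<Rightarrow> bool" where
  "moves_to Q z x z' x' \<longleftrightarrow>
     (\<forall>i\<in>UNIV. coord i x' - coord i x = (\<Sum>j\<in>UNIV. Q $ i $ j * (coord j z' - coord j z)))"

lemma moves_to_cell_code:
  "moves_to Q (cell_code z) (cell_code x) (cell_code z') (cell_code x') \<longleftrightarrow>
     x' = Q *v z' + (x - Q *v z)"
proof -
  have "x' = Q *v z' + (x - Q *v z) \<longleftrightarrow> x' - x = Q *v (z' - z)"
    by (auto simp: matrix_vector_mult_diff_distrib algebra_simps)
  also have "\<dots> \<longleftrightarrow> moves_to Q (cell_code z) (cell_code x) (cell_code z') (cell_code x')"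
    by (simp add: moves_to_def vec_eq_iff matrix_vector_mult_def)
  finally show ?thesis ..
qed

lemma rec_pred_moves_to [rec_intros]:
  assumes "rec_fun k z" "rec_fun k x" "rec_fun k z'" "rec_fun k x'"
  shows "rec_pred k (\<lambda>xs. moves_to Q (z xs) (x xs) (z' xs) (x' xs))"
  unfolding moves_to_def coord_def
  by (intro rec_intros rec_pred_Ball_finite rec_int_sum assms finite_class.finite_UNIV)

text \<open>The inner conjuncts are the two inclusions between the moved \<open>t\<close> and
  \<open>p\<close>. All quantifiers range over coded sets or over \<open>M\<close>, which is to be
  the finite set of grid rotations.\<close>

definition copy_check :: "(int ^ 'n ^ 'n::finite) set \<Rightarrow> nat \<Rightarrow> nat \<Rightarrow> bool" where
  "copy_check M p t \<longleftrightarrow> (\<exists>Q\<in>M. \<exists>z\<in>set_decode t. \<exists>x\<in>set_decode p.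
     (\<forall>z'\<in>set_decode t. \<exists>x'\<in>set_decode p. moves_to Q z x z' x') \<and>
     (\<forall>x'\<in>set_decode p. \<exists>z'\<in>set_decode t. moves_to Q z x z' x'))"

lemma rec_pred_copy_check [rec_intros]:
  assumes "finite M" "rec_fun k f" "rec_fun k g"
  shows "rec_pred k (\<lambda>xs. copy_check M (f xs) (g xs))"
proof (rule rec_pred_comp2[OF _ assms(2,3)])
  show "rec_pred (Suc (Suc 0)) (\<lambda>ys. copy_check M (hd ys) (hd (tl ys)))"
    unfolding copy_check_def by (intro rec_pred_Bex_finite assms(1) rec_intros; simp)
qed

lemma set_decode_poly_code: "finite P \<Longrightarrow> set_decode (poly_code P) = cell_code ` P"
  by (simp add: poly_code_def)

lemma set_decode_family_code: "finite T \<Longrightarrow> set_decode (family_code T) = poly_code ` T"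
  by (simp add: family_code_def)

text \<open>The translation is \<open>x - Q *v z\<close> for any corresponding cells
  \<open>z\<close> and \<open>x\<close>; \<open>z\<close> exists because \<open>t\<close> is
  nonempty.\<close>

lemma copy_check_poly_code:
  fixes P t :: "'n::finite cell set"
  assumes "finite P" "finite t" "t \<noteq> {}"
  shows "copy_check {Q :: int ^ 'n ^ 'n. rotation_matrix Q} (poly_code P) (poly_code t) \<longleftrightarrow> copy_of P t"
proof -
  have "copy_check {Q :: int ^ 'n ^ 'n. rotation_matrix Q} (poly_code P) (poly_code t) \<longleftrightarrow>
    (\<exists>Q :: int ^ 'n ^ 'n. rotation_matrix Q \<and>
      (\<exists>z\<in>t. \<exists>x\<in>P. P = (\<lambda>z'. Q *v z' + (x - Q *v z)) ` t))"
    unfolding copy_check_def set_decode_poly_code[OF assms(1)] set_decode_poly_code[OF assms(2)]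
      bex_simps ball_simps moves_to_cell_code mem_Collect_eq Bex_def[of "Collect _"]
    by (intro ex_cong1 conj_cong refl bex_cong) blast
  also have "\<dots> \<longleftrightarrow> copy_of P t"
  proof
    assume "copy_of P t"
    then obtain Q :: "int ^ 'n ^ 'n" and v
      where Q: "rotation_matrix Q" and P: "P = (\<lambda>x. Q *v x + v) ` t"
      by (auto simp: copy_of_def)
    obtain z where z: "z \<in> t" using assms(3) by blast
    have "Q *v z + v \<in> P" using P z by blast
    moreover have "P = (\<lambda>z'. Q *v z' + (Q *v z + v - Q *v z)) ` t" using P by simp
    ultimately show "\<exists>Q :: int ^ 'n ^ 'n. rotation_matrix Q \<and>
      (\<exists>z\<in>t. \<exists>x\<in>P. P = (\<lambda>z'. Q *v z' + (x - Q *v z)) ` t)"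
      using Q z by blast
  qed (auto simp only: copy_of_def)
  finally show ?thesis .
qed

section \<open>The tiling test and the range of the search\<close>

text \<open>If \<open>r\<close> is the code of a region, the third conjunct also ensures that the
  members of \<open>y\<close> contain only codes of cells, so that an accepted \<open>y\<close> can
  be decoded.\<close>

definition tiling_check :: "(int ^ 'n ^ 'n::finite) set \<Rightarrow> nat \<Rightarrow> nat \<Rightarrow> nat \<Rightarrow> bool" where
  "tiling_check M f r y \<longleftrightarrow>
     (\<forall>p\<in>set_decode y. \<exists>t\<in>set_decode f. copy_check M p t) \<and>
     (\<forall>p\<in>set_decode y. \<forall>q\<in>set_decode y. p \<noteq> q \<longrightarrow> (\<forall>c\<in>set_decode p. c \<notin> set_decode q)) \<and>
     (\<forall>p\<in>set_decode y. \<forall>c\<in>set_decode p. c \<in> set_decode r) \<and>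
     (\<forall>c\<in>set_decode r. \<exists>p\<in>set_decode y. c \<in> set_decode p)"

text \<open>The bound makes the search halt even without a tiling; its value is then the bound
  itself.\<close>

lemma rec_fun_search:
  assumes "finite M"
  shows "rec_fun (Suc (Suc 0))
    (\<lambda>xs. LEAST y. tiling_check M (hd xs) (hd (tl xs)) y \<or> 2 ^ Suc (hd (tl xs)) \<le> y)"
  unfolding tiling_check_def by (intro rec_intros assms; simp)

lemma tiling_check_family_code:
  fixes R :: "'n::finite cell set"
  assumes F: "finite F" "\<And>t. t \<in> F \<Longrightarrow> finite t \<and> t \<noteq> {}" and R: "finite R"
    and T: "finite T" "\<And>P. P \<in> T \<Longrightarrow> finite P"
  shows "tiling_check {Q :: int ^ 'n ^ 'n. rotation_matrix Q}
    (family_code F) (poly_code R) (family_code T) \<longleftrightarrow> tiling F R T"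
proof -
  have copy: "copy_check {Q :: int ^ 'n ^ 'n. rotation_matrix Q} (poly_code P) (poly_code t) \<longleftrightarrow> copy_of P t"
    if "P \<in> T" "t \<in> F" for P t
    using F(2)[OF that(2)] T(2)[OF that(1)] by (intro copy_check_poly_code) auto
  have eq: "poly_code P = poly_code P' \<longleftrightarrow> P = P'" if "P \<in> T" "P' \<in> T" for P P'
    using that T(2) inj_onD[OF inj_poly_code, of P P'] by auto
  have mem: "cell_code c \<in> set_decode (poly_code P) \<longleftrightarrow> c \<in> P" if "P \<in> T" for c P
    using T(2)[OF that] by (simp add: set_decode_poly_code inj_image_mem_iff[OF inj_cell_code])
  have ball: "(\<forall>c\<in>set_decode (poly_code P). A c) \<longleftrightarrow> (\<forall>c\<in>P. A (cell_code c))" if "P \<in> T" for A P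
    using T(2)[OF that] by (simp add: set_decode_poly_code)
  have "tiling_check {Q :: int ^ 'n ^ 'n. rotation_matrix Q}
      (family_code F) (poly_code R) (family_code T) \<longleftrightarrow>
    (\<forall>P\<in>T. \<exists>t\<in>F. copy_of P t) \<and> (\<forall>P\<in>T. \<forall>P'\<in>T. P \<noteq> P' \<longrightarrow> (\<forall>c\<in>P. c \<notin> P')) \<and>
    (\<forall>P\<in>T. \<forall>c\<in>P. c \<in> R) \<and> (\<forall>c\<in>R. \<exists>P\<in>T. c \<in> P)"
    unfolding tiling_check_def set_decode_family_code[OF F(1)] set_decode_family_code[OF T(1)]
      set_decode_poly_code[OF R] ball_simps bex_simps
    by (simp only: copy eq mem ball inj_image_mem_iff[OF inj_cell_code] cong: ball_cong bex_cong)
  also have "\<dots> \<longleftrightarrow> tiling F R T"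
  proof -
    have "disjoint T \<longleftrightarrow> (\<forall>P\<in>T. \<forall>P'\<in>T. P \<noteq> P' \<longrightarrow> (\<forall>c\<in>P. c \<notin> P'))"
      by (simp add: disjoint_def disjoint_iff) blast
    moreover have "\<Union>T = R \<longleftrightarrow> (\<forall>P\<in>T. \<forall>c\<in>P. c \<in> R) \<and> (\<forall>c\<in>R. \<exists>P\<in>T. c \<in> P)"
      by auto
    ultimately show ?thesis by (simp only: tiling_def)
  qed
  finally show ?thesis .
qed

text \<open>All elements of the decoded sets are codes of cells of \<open>R\<close>, so taking
  preimages under \<open>cell_code\<close> loses nothing and encoding gives \<open>y\<close>
  back.\<close>

lemma family_code_exists:
  fixes R :: "'n::finite cell set"
  assumes "finite R" "\<And>p. p \<in> set_decode y \<Longrightarrow> set_decode p \<subseteq> set_decode (poly_code R)"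
  obtains T :: "'n cell set set" where "finite T" "\<And>P. P \<in> T \<Longrightarrow> finite P" "y = family_code T"
proof
  define g :: "nat \<Rightarrow> 'n cell set" where "g p = cell_code -` set_decode p" for p
  have fin: "finite (g p)" for p
    unfolding g_def by (simp add: finite_vimageI inj_cell_code)
  have "poly_code (g p) = p" if "p \<in> set_decode y" for p
  proof -
    have "cell_code ` g p = set_decode p"
      using assms(2)[OF that] unfolding g_def set_decode_poly_code[OF assms(1)] by blast
    then show ?thesis by (simp add: poly_code_def)
  qed
  then have "poly_code ` g ` set_decode y = set_decode y" by (simp add: image_image)
  then show "y = family_code (g ` set_decode y)" by (simp add: family_code_def)
  show "finite (g ` set_decode y)" "\<And>P. P \<in> g ` set_decode y \<Longrightarrow> finite P" using fin by auto
qed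

text \<open>\<open>set_encode\<close> sums distinct powers of 2, hence is monotone. With
  \<open>r\<close> the code of \<open>R\<close>, members have codes at most \<open>r\<close>, and
  the family has a code at most \<open>2 ^ 0 + ... + 2 ^ r\<close>.\<close>

lemma family_code_less:
  assumes "finite R" "T \<subseteq> Pow R"
  shows "family_code T < 2 ^ Suc (poly_code R)"
proof -
  have sum_less: "(\<Sum>k<n. 2 ^ k) < (2 :: nat) ^ n" for n
    by (induction n) auto
  have "poly_code P \<le> poly_code R" if "P \<in> T" for P
    unfolding poly_code_def set_encode_def
    using assms that by (intro sum_mono2) auto
  then have "poly_code ` T \<subseteq> {..<Suc (poly_code R)}" by (auto simp: less_Suc_eq_le)
  then have "family_code T \<le> (\<Sum>k<Suc (poly_code R). 2 ^ k)"
    unfolding family_code_def set_encode_def by (intro sum_mono2) auto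
  also have "\<dots> < 2 ^ Suc (poly_code R)" by (rule sum_less)
  finally show ?thesis .
qed

section \<open>Finiteness of the set of grid rotations\<close>

lemma finite_vec_set:
  assumes "finite A"
  shows "finite {v :: 'a ^ 'n::finite. \<forall>i. v $ i \<in> A}"
proof (rule finite_subset)
  show "{v :: 'a ^ 'n. \<forall>i. v $ i \<in> A} \<subseteq> vec_lambda ` (UNIV \<rightarrow>\<^sub>E A)"
    by (auto simp: PiE_UNIV_domain intro!: image_eqI[where x = "vec_nth _"])
  show "finite (vec_lambda ` (UNIV \<rightarrow>\<^sub>E A))" using assms by (intro finite_imageI finite_PiE) auto
qed

text \<open>Each row is an integer vector of norm 1, so its entries lie between -1 and 1.\<close>

lemma finite_rotation_matrix: "finite {Q :: int ^ 'n ^ 'n::finite. rotation_matrix Q}"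
proof (rule finite_subset)
  show "finite {Q :: int ^ 'n ^ 'n. \<forall>i. Q $ i \<in> {v. \<forall>j. v $ j \<in> {-1..1}}}"
    by (intro finite_vec_set) simp
  show "{Q :: int ^ 'n ^ 'n. rotation_matrix Q} \<subseteq> {Q. \<forall>i. Q $ i \<in> {v. \<forall>j. v $ j \<in> {-1..1}}}"
  proof clarify
    fix Q :: "int ^ 'n ^ 'n" and i j
    assume "rotation_matrix Q"
    then have "(Q ** transpose Q) $ i $ i = 1"
      by (simp add: rotation_matrix_def orthogonal_matrix_def mat_def)
    then have "(\<Sum>j\<in>UNIV. (Q $ i $ j)\<^sup>2) = 1"
      by (simp add: matrix_matrix_mult_def transpose_def power2_eq_square)
    then have "(Q $ i $ j)\<^sup>2 \<le> 1"
      using member_le_sum[of j UNIV "\<lambda>j. (Q $ i $ j)\<^sup>2"] by simp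
    then show "Q $ i $ j \<in> {-1..1}" by (simp add: abs_square_le_1 abs_le_iff)
  qed
qed

text \<open>Every placed copy lies in \<open>R\<close>, so its tile fits inside \<open>R\<close> and
  is represented in \<open>F\<close>.\<close>

lemma tiling_presents:
  assumes "presents F S R" "tiling S R T"
  shows "tiling F R T"
proof -
  have "\<exists>t\<in>F. copy_of P t" if P: "P \<in> T" for P
  proof -
    obtain t where t: "t \<in> S" "copy_of P t" using assms(2) P unfolding tiling_def by blast
    have "P \<subseteq> R" using assms(2) P unfolding tiling_def by blast
    then obtain t' where "t' \<in> F" "copy_of t' t"
      using assms(1) t unfolding presents_def fits_def by blast
    then show ?thesis using t(2) copy_of_sym copy_of_trans by blast
  qed
  then show ?thesis using assms(2) unfolding tiling_def by blast
qed

lemma tiling_mono: "tiling F R T \<Longrightarrow> F \<subseteq> S \<Longrightarrow> tiling S R T"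
  unfolding tiling_def by blast

theorem theorem3p4:
  shows "(\<forall>S :: 'n::finite cell set set. fountain_set S \<longrightarrow>
            (\<forall>R \<in> generated_class S. tileable S R)) \<and>
         (\<exists>A. \<forall>(S :: 'n cell set set) F R. fountain_set S \<and> polyomino R \<and> presents F S R \<longrightarrow>
            (\<exists>y. computes A [family_code F, poly_code R] y \<and>
              (tileable S R \<longrightarrow> (\<exists>T. tiling S R T \<and> y = family_code T))))"
proof
  show "\<forall>S :: 'n cell set set. fountain_set S \<longrightarrow> (\<forall>R \<in> generated_class S. tileable S R)"
    by (auto simp: generated_class_def generating_tiles_def intro: tileable_if_fits)
  let ?M = "{Q :: int ^ 'n ^ 'n. rotation_matrix Q}"
  let ?ok = "\<lambda>f r y. tiling_check ?M f r y \<or> 2 ^ Suc r \<le> y"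
  \<comment> \<open>The program is chosen before \<open>S\<close>, \<open>F\<close> and
    \<open>R\<close>; only the dimension enters, through \<open>?M\<close>.\<close>
  obtain A where A: "\<And>xs. length xs = Suc (Suc 0) \<Longrightarrow>
      computes A xs (LEAST y. ?ok (hd xs) (hd (tl xs)) y)"
    using rec_fun_search[OF finite_rotation_matrix] unfolding rec_fun_def by blast
  show "\<exists>A. \<forall>(S :: 'n cell set set) F R. fountain_set S \<and> polyomino R \<and> presents F S R \<longrightarrow>
      (\<exists>y. computes A [family_code F, poly_code R] y \<and>
        (tileable S R \<longrightarrow> (\<exists>T. tiling S R T \<and> y = family_code T)))"
  proof (intro exI[of _ A] allI impI)
    fix S F :: "'n cell set set" and R :: "'n cell set"
    assume asm: "fountain_set S \<and> polyomino R \<and> presents F S R"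
    define y where "y = (LEAST y. ?ok (family_code F) (poly_code R) y)"
    have R: "finite R" using asm by (simp add: polyomino_def)
    have F: "finite F" "F \<subseteq> S" using asm by (auto simp: presents_def)
    have tile: "finite t \<and> t \<noteq> {}" if "t \<in> F" for t
      using asm that F(2) by (auto simp: fountain_set_def tile_def polyomino_def)
    have "\<exists>T. tiling S R T \<and> y = family_code T" if tileable: "tileable S R"
    proof -
      obtain T where T: "tiling S R T" using tileable by (auto simp: tileable_def)
      then have sub: "T \<subseteq> Pow R" by (auto simp: tiling_def)
      have fin: "finite T" "\<And>P. P \<in> T \<Longrightarrow> finite P"
        using sub R by (auto intro: finite_subset rev_finite_subset)
      have "tiling F R T" using tiling_presents T asm by blast
      then have check: "tiling_check ?M (family_code F) (poly_code R) (family_code T)"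
        using tiling_check_family_code[OF F(1) tile R fin] by blast
      \<comment> \<open>The code of \<open>T\<close> is accepted below the bound, so the least value
        \<open>y\<close> passes the test itself instead of merely reaching the bound.\<close>
      have "y \<le> family_code T" unfolding y_def by (rule Least_le) (simp add: check)
      also have "\<dots> < 2 ^ Suc (poly_code R)" by (rule family_code_less[OF R sub])
      finally have "y < 2 ^ Suc (poly_code R)" .
      moreover have "?ok (family_code F) (poly_code R) y"
        unfolding y_def by (rule LeastI[of _ "family_code T"]) (simp add: check)
      ultimately have y: "tiling_check ?M (family_code F) (poly_code R) y" by simp
      \<comment> \<open>The search may have found a tiling other than \<open>T\<close>, so
        \<open>y\<close> is decoded afresh.\<close>
      then obtain U :: "'n cell set set"
        where U: "finite U" "\<And>P. P \<in> U \<Longrightarrow> finite P" "y = family_code U"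
        using family_code_exists[OF R, of y] unfolding tiling_check_def by blast
      have "tiling F R U"
        using y tiling_check_family_code[OF F(1) tile R U(1,2)] unfolding U(3) by blast
      then show ?thesis using tiling_mono F(2) U(3) by blast
    qed
    \<comment> \<open>The program halts whether or not \<open>R\<close> is tileable.\<close>
    moreover have "computes A [family_code F, poly_code R] y"
      using A[of "[family_code F, poly_code R]"] by (simp add: y_def)
    ultimately show "\<exists>y. computes A [family_code F, poly_code R] y \<and>
        (tileable S R \<longrightarrow> (\<exists>T. tiling S R T \<and> y = family_code T))" by blast
  qed
qed

end
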